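(* Let $f \in \mathbb{C}[z_1,z_2]$ be of total degree $d$, and assume that its homogenization $f_h \in \mathbb{C}[z_0,z_1,z_2]$ has the zeros at infinity $(0:1:a_j) \in \mathbb{P}^2_{\mathbb{C}}$, $j = 1,\ldots,d$. Then $$\mathcal{I}_\infty(f) = \begin{cases} \bigcup_{j=1}^d \left\{ \pm \frac{1}{\sqrt{1+a_j^2}} (1,a_j) \right\} & \text{if all } a_j \text{ are real},\\ \mathbb{S}^1 & \text{otherwise}.\end{cases}$$
   Context: For $f \in \mathbb{C}[z_1,\ldots,z_n]$, the imaginary projection of $f$ is $\mathcal{I}(f) = \{\operatorname{Im}(\mathbf{z}) : \mathbf{z} \in \mathbb{C}^n,\ f(\mathbf{z}) = 0\} \subseteq \mathbb{R}^n$, with imaginary parts taken componentwise. $\mathbb{S}^{n-1}$ is the Euclidean unit sphere in $\mathbb{R}^n$. The set of limit directions is $\mathcal{I}_\infty(f) = \lim_{r \to \infty}\left(\frac1r \mathcal{I}(f) \cap \mathbb{S}^{n-1}\right)$, meaning the set of limit points, as $r \to \infty$, of points of $\frac1r \mathcal{I}(f) \cap \mathbb{S}^{n-1}$. The homogenization of $f$ of total degree $d$ is $f_h(z_0,z_1,z_2) = z_0^d f(z_1/z_0,z_2/z_0)$, and its zeros at infinity are its zeros in $\mathbb{P}^2_{\mathbb{C}}$ with $z_0 = 0$.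
   Formalization: If all a_j are real, they are assumed pairwise distinct: with repeated real zeros at infinity the formula fails, e.g. f = z_2^2 - z_1 (a_1 = a_2 = 0) has limit directions the whole circle S^1. Repetitions remain allowed when some a_j is non-real. *)

theory Defs
  imports "HOL-Analysis.Analysis" "HOL-Library.Poly_Mapping"
begin

text \<open>Polynomials over the complex numbers in variables indexed by a finite type \<open>'n\<close>:
  finitely supported maps from exponent vectors to coefficients.\<close>

type_synonym 'n cpoly = "('n \<Rightarrow>\<^sub>0 nat) \<Rightarrow>\<^sub>0 complex"

definition peval :: "'n::finite cpoly \<Rightarrow> complex ^ 'n \<Rightarrow> complex" where
  "peval f z = (\<Sum>m\<in>Poly_Mapping.keys f.
      Poly_Mapping.lookup f m * (\<Prod>i\<in>UNIV. z $ i ^ Poly_Mapping.lookup m i))"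

definition mon_degree :: "('n::finite \<Rightarrow>\<^sub>0 nat) \<Rightarrow> nat" where
  "mon_degree m = (\<Sum>i\<in>UNIV. Poly_Mapping.lookup m i)"

text \<open>The zero polynomial gets total degree 0.\<close>

definition total_degree :: "'n::finite cpoly \<Rightarrow> nat" where
  "total_degree f = Max (insert 0 (mon_degree ` Poly_Mapping.keys f))"

definition imaginary_projection :: "'n::finite cpoly \<Rightarrow> (real ^ 'n) set" where
  "imaginary_projection f = {(\<chi> i. Im (z $ i)) | z. peval f z = 0}"

text \<open>The limit is the set of all limits \<open>lim q\<^sub>k\<close> of points
  \<open>q\<^sub>k \<in> (1/r\<^sub>k) I(f) \<inter> S\<close> along sequences \<open>r\<^sub>k \<rightarrow> \<infinity>\<close>
  (the upper Kuratowski limit).\<close>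

definition limit_directions :: "'n::finite cpoly \<Rightarrow> (real ^ 'n) set" where
  "limit_directions f =
     {p. \<exists>(r :: nat \<Rightarrow> real) q. filterlim r at_top sequentially \<and>
           (\<forall>k. q k \<in> (\<lambda>y. (1 / r k) *\<^sub>R y) ` imaginary_projection f \<inter> sphere 0 1) \<and>
           q \<longlonglongrightarrow> p}"

text \<open>Homogeneous coordinates are indexed by \<open>'n option\<close>; \<open>None\<close> is the index of the
  homogenizing variable \<open>z\<^sub>0\<close>.\<close>

definition homogenization :: "'n::finite cpoly \<Rightarrow> 'n option cpoly" where
  "homogenization f = (\<Sum>m\<in>Poly_Mapping.keys f.
      Poly_Mapping.single
        (Poly_Mapping.single None (total_degree f - mon_degree m) +
         (\<Sum>i\<in>UNIV. Poly_Mapping.single (Some i) (Poly_Mapping.lookup m i)))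
        (Poly_Mapping.lookup f m))"

definition hom_coords :: "complex \<Rightarrow> complex ^ 'n \<Rightarrow> complex ^ 'n::finite option" where
  "hom_coords z0 z = (\<chi> i. case i of None \<Rightarrow> z0 | Some k \<Rightarrow> z $ k)"

text \<open>The point of complex projective space represented by \<open>z \<noteq> 0\<close>, as the set of all its
  homogeneous coordinate vectors.\<close>

definition proj_point :: "complex ^ 'm \<Rightarrow> (complex ^ 'm::finite) set" where
  "proj_point z = {c *s z | c. c \<noteq> 0}"

definition zeros_at_infinity :: "'n::finite cpoly \<Rightarrow> (complex ^ 'n option) set set" where
  "zeros_at_infinity f =
     {proj_point z | z. z \<noteq> 0 \<and> z $ None = 0 \<and> peval (homogenization f) z = 0}"

text \<open>This is a set of points, without multiplicities. Multiplicities do matter for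
  \<open>limit_directions\<close>: the only zero at infinity of \<open>f = z\<^sub>2\<^sup>2 - z\<^sub>1\<close> is the double point
  \<open>(0:1:0)\<close>, but \<open>Im z\<^sub>1 = 2 Re z\<^sub>2 Im z\<^sub>2\<close> on the curve, so \<open>imaginary_projection f\<close>
  contains every \<open>y\<close> with \<open>y\<^sub>2 \<noteq> 0\<close> and every point of the unit circle is a limit direction.
  Hence "the zeros at infinity \<open>(0:1:a\<^sub>j)\<close>, \<open>j = 1, \<dots>, d\<close>" has to mean \<open>d\<close> distinct points
  when all \<open>a\<^sub>j\<close> are real; if some \<open>a\<^sub>j\<close> is not real, repetitions are harmless.\<close>

lemma peval_superset:
  assumes "finite A" "Poly_Mapping.keys f \<subseteq> A"
  shows "peval f z = (\<Sum>m\<in>A. Poly_Mapping.lookup f m * (\<Prod>i\<in>UNIV. z $ i ^ Poly_Mapping.lookup m i))"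
  unfolding peval_def using assms by (intro sum.mono_neutral_left) (auto simp: in_keys_iff)

lemma peval_add: "peval (f + g) z = peval f z + peval g z"
proof -
  let ?A = "Poly_Mapping.keys f \<union> Poly_Mapping.keys g"
  have "Poly_Mapping.keys (f + g) \<subseteq> ?A" by (rule Poly_Mapping.keys_add)
  then show ?thesis
    by (simp add: peval_superset[of ?A] lookup_add sum.distrib[symmetric] distrib_right)
qed

lemma peval_zero: "peval 0 z = 0"
  by (simp add: peval_def)

lemma peval_sum: "peval (\<Sum>x\<in>A. g x) z = (\<Sum>x\<in>A. peval (g x) z)"
  by (induction A rule: infinite_finite_induct) (auto simp: peval_add peval_zero)

lemma peval_single:
  "peval (Poly_Mapping.single m c) z = c * (\<Prod>i\<in>UNIV. z $ i ^ Poly_Mapping.lookup m i)"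
  by (simp add: peval_def)

lemma mon_degree_le_total_degree:
  "m \<in> Poly_Mapping.keys f \<Longrightarrow> mon_degree m \<le> total_degree f"
  unfolding total_degree_def by (intro Max_ge) auto

lemma peval_homogenization:
  "peval (homogenization f) (hom_coords z0 z) =
     (\<Sum>m\<in>Poly_Mapping.keys f. Poly_Mapping.lookup f m * z0 ^ (total_degree f - mon_degree m) *
        (\<Prod>i\<in>UNIV. z $ i ^ Poly_Mapping.lookup m i))"
proof -
  have l: "Poly_Mapping.lookup (\<Sum>i\<in>UNIV. Poly_Mapping.single (Some i) (g i)) x =
      (case x of None \<Rightarrow> 0 | Some i \<Rightarrow> g i)" for g :: "'a \<Rightarrow> nat" and x
    by (cases x) (auto simp: lookup_sum lookup_single when_def)
  show ?thesis
    by (simp add: homogenization_def peval_sum peval_single hom_coords_def lookup_add l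
        UNIV_option_conv prod.reindex mult.assoc lookup_single)
qed

text \<open>The defining formula of the homogenization:\<close>

lemma peval_homogenization_affine:
  assumes "z0 \<noteq> 0"
  shows "peval (homogenization f) (hom_coords z0 z) =
           z0 ^ total_degree f * peval f ((1 / z0) *s z)"
proof -
  have "z0 ^ (total_degree f - mon_degree m) * (\<Prod>i\<in>UNIV. z $ i ^ Poly_Mapping.lookup m i) =
     z0 ^ total_degree f * (\<Prod>i\<in>UNIV. (((1 / z0) *s z) $ i) ^ Poly_Mapping.lookup m i)"
    if "m \<in> Poly_Mapping.keys f" for m
    using mon_degree_le_total_degree[OF that] assms
    by (simp add: power_diff power_divide prod_dividef mon_degree_def power_sum)
  then show ?thesis
    unfolding peval_homogenization unfolding peval_def sum_distrib_left
    by (intro sum.cong) (simp_all add: mult.assoc mult.left_commute)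
qed

end

theory Submission
  imports Defs "HOL-Computational_Algebra.Fundamental_Theorem_Algebra"
begin

text \<open>Let \<open>F\<close> be the leading form of \<open>f\<close>. If \<open>F(1, a) = 0\<close> and \<open>s\<close> is a complex number, then
  \<open>f(n s, t) = 0\<close> has a root \<open>t\<close> with \<open>t / n \<longlongrightarrow> a s\<close>, because the value of \<open>f\<close> at \<open>(n s, n a s)\<close>
  has order at most \<open>n^(d - 1)\<close>. So \<open>(Im s, Im (a s))\<close> is a limit direction whenever it is a unit
  vector. For non-real \<open>a\<close> the real linear map \<open>s \<mapsto> (Im s, Im (a s))\<close> is onto, which gives the whole
  circle; for real \<open>a\<close> this gives the two directions \<open>\<plusminus>(1, a)\<close>.

  Conversely, let all \<open>a\<^sub>j\<close> be real and distinct, so \<open>F = c \<Prod> (z\<^sub>2 - a\<^sub>j z\<^sub>1)\<close>. Suppose that a zero \<open>z\<close> of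
  \<open>f\<close> has \<open>Im z = r q\<close> with \<open>q\<close> bounded away from all lines \<open>y\<^sub>2 = a\<^sub>j y\<^sub>1\<close>. Then every linear factor is
  at least of order \<open>r\<close>, and all but one of them are of order \<open>|z|\<close>, while
  \<open>|F(z)| = |f(z) - F(z)|\<close> is at most of order \<open>|z|^(d - 1)\<close>. Hence \<open>r\<close> is bounded.\<close>


section \<open>Roots of a complex polynomial near points where its value is small\<close>

text \<open>The value at \<open>x\<close> is the leading coefficient times the product of the
  distances from \<open>x\<close> to the roots, and each of these is at least the distance to the
  nearest root. The induction splits off one root at a time.\<close>

lemma poly_root_near:
  fixes p :: "complex poly"
  assumes "degree p = Suc n"
  shows "\<exists>r. poly p r = 0 \<and> norm (lead_coeff p) * norm (x - r) ^ Suc n \<le> norm (poly p x)"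
  using assms
proof (induction n arbitrary: p)
  case (0 p)
  then obtain b c where p: "p = [:b, c:]" "c \<noteq> 0"
    by (metis One_nat_def degree1_coeffs)
  have "c * (x + b / c) = b + x * c"
    using p by (simp add: field_simps)
  then have "norm c * norm (x + b / c) = norm (b + x * c)"
    by (metis norm_mult)
  then show ?case
    using p by (intro exI[of _ "- b / c"]) (simp add: field_simps)
next
  case (Suc n p)
  then have "\<not> constant (poly p)"
    by (simp add: constant_degree)
  then obtain b where b: "poly p b = 0"
    using fundamental_theorem_of_algebra by blast
  then obtain q where p: "p = [:-b, 1:] * q"
    by (metis dvdE poly_eq_0_iff_dvd)
  have "q \<noteq> 0" using p Suc.prems by auto
  then have dq: "degree q = Suc n"
    using Suc.prems by (simp add: p degree_mult_eq del: mult_pCons_left)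
  then obtain r where r: "poly q r = 0" "norm (lead_coeff q) * norm (x - r) ^ Suc n \<le> norm (poly q x)"
    using Suc.IH by blast
  have lc: "lead_coeff p = lead_coeff q"
    unfolding p lead_coeff_mult by simp
  \<comment> \<open>The distance from \<open>x\<close> to the closer of the two candidates: the root
    \<open>b\<close> just split off and the root \<open>r\<close> of the quotient.\<close>
  define e where "e = min (norm (x - b)) (norm (x - r))"
  have "norm (lead_coeff q) * e ^ Suc (Suc n) = e * (norm (lead_coeff q) * e ^ Suc n)"
    by simp
  also have "\<dots> \<le> norm (x - b) * (norm (lead_coeff q) * norm (x - r) ^ Suc n)"
    by (intro mult_mono power_mono) (auto simp: e_def)
  also have "\<dots> \<le> norm (x - b) * norm (poly q x)"
    using r by (intro mult_left_mono) auto
  also have "\<dots> = norm (poly p x)"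
    by (simp add: p norm_mult[symmetric] algebra_simps)
  finally have e: "norm (lead_coeff p) * e ^ Suc (Suc n) \<le> norm (poly p x)"
    by (simp add: lc)
  have "e = norm (x - b) \<or> e = norm (x - r)"
    by (auto simp: e_def)
  then show ?case
    using e b r(1) p by (metis mult_zero_right poly_mult)
qed

section \<open>The leading form and the one-variable sections\<close>

text \<open>Setting the homogenizing variable to 0 leaves the top-degree part of \<open>f\<close>.
  Defining it through \<open>homogenization\<close> ties it directly to
  \<open>zeros_at_infinity\<close>.\<close>

definition lead_form :: "'n::finite cpoly \<Rightarrow> complex ^ 'n \<Rightarrow> complex" where
  "lead_form f z = peval (homogenization f) (hom_coords 0 z)"

text \<open>Since \<open>0 ^ 0 = 1\<close>, the power of 0 is the indicator of the monomials of top
  degree.\<close>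

lemma lead_form_eq:
  "lead_form f z = (\<Sum>m\<in>Poly_Mapping.keys f. Poly_Mapping.lookup f m *
      0 ^ (total_degree f - mon_degree m) * (\<Prod>i\<in>UNIV. z $ i ^ Poly_Mapping.lookup m i))"
  by (simp add: lead_form_def peval_homogenization)

lemma lead_form_scale: "lead_form f (k *s z) = k ^ total_degree f * lead_form f z"
proof -
  have "0 ^ (total_degree f - mon_degree m) * (\<Prod>i\<in>UNIV. (k *s z) $ i ^ Poly_Mapping.lookup m i) =
     k ^ total_degree f * (0 ^ (total_degree f - mon_degree m) *
       (\<Prod>i\<in>UNIV. z $ i ^ Poly_Mapping.lookup m i))"
    if "m \<in> Poly_Mapping.keys f" for m
    using mon_degree_le_total_degree[OF that]
    by (cases "mon_degree m = total_degree f")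
      (auto simp: power_mult_distrib prod.distrib power_sum[symmetric] mon_degree_def[symmetric])
  then show ?thesis
    unfolding lead_form_eq sum_distrib_left
    by (intro sum.cong) (simp_all add: mult.assoc mult.left_commute)
qed

text \<open>Only monomials of degree below \<open>total_degree f\<close> survive in the difference;
  \<open>M\<close> is the sum of the norms of all coefficients. The factor \<open>N\<close> on the
  left replaces an exponent lowered by 1 on the right, which would be truncated for constant
  \<open>f\<close>.\<close>

lemma peval_lead_form_bound:
  fixes f :: "'n::finite cpoly"
  shows "\<exists>M. \<forall>z N. 1 \<le> N \<longrightarrow> (\<forall>i. norm (z $ i) \<le> N) \<longrightarrow>
    N * norm (peval f z - lead_form f z) \<le> M * N ^ total_degree f"
proof (intro exI allI impI)
  fix z :: "complex ^ 'n" and N :: real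
  assume N: "1 \<le> N" and "\<forall>i. norm (z $ i) \<le> N"
  then have z: "norm (z $ i) \<le> N" for i
    by blast
  let ?d = "total_degree f"
  let ?p = "\<lambda>m. \<Prod>i\<in>UNIV. z $ i ^ Poly_Mapping.lookup m i"
  have diff: "peval f z - lead_form f z = (\<Sum>m\<in>Poly_Mapping.keys f.
      Poly_Mapping.lookup f m * ((1 - 0 ^ (?d - mon_degree m)) * ?p m))"
    unfolding peval_def lead_form_eq sum_subtractf[symmetric]
    by (intro sum.cong) (simp_all add: algebra_simps)
  have "N * norm (Poly_Mapping.lookup f m * ((1 - 0 ^ (?d - mon_degree m)) * ?p m))
      \<le> norm (Poly_Mapping.lookup f m) * N ^ ?d" if m: "m \<in> Poly_Mapping.keys f" for m
  proof (cases "mon_degree m = ?d")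
    case False
    then have less: "mon_degree m < ?d"
      using mon_degree_le_total_degree[OF m] by simp
    have "norm (?p m) \<le> (\<Prod>i\<in>UNIV. N ^ Poly_Mapping.lookup m i)"
      unfolding prod_norm[symmetric] norm_power
      by (intro prod_mono) (auto intro: power_mono z)
    also have "\<dots> = N ^ mon_degree m"
      by (simp add: power_sum mon_degree_def)
    finally have "N * norm (?p m) \<le> N ^ Suc (mon_degree m)"
      using N by simp
    also have "\<dots> \<le> N ^ ?d"
      using less N by (intro power_increasing) auto
    finally have "norm (Poly_Mapping.lookup f m) * (N * norm (?p m))
        \<le> norm (Poly_Mapping.lookup f m) * N ^ ?d"
      by (intro mult_left_mono) auto
    then show ?thesis
      using less by (simp add: norm_mult mult_ac power_0_left)
  qed (use N in simp)
  then have "(\<Sum>m\<in>Poly_Mapping.keys f.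
       N * norm (Poly_Mapping.lookup f m * ((1 - 0 ^ (?d - mon_degree m)) * ?p m)))
     \<le> (\<Sum>m\<in>Poly_Mapping.keys f. norm (Poly_Mapping.lookup f m) * N ^ ?d)"
    by (intro sum_mono)
  moreover have "N * norm (peval f z - lead_form f z) \<le> (\<Sum>m\<in>Poly_Mapping.keys f.
       N * norm (Poly_Mapping.lookup f m * ((1 - 0 ^ (?d - mon_degree m)) * ?p m)))"
    unfolding diff sum_distrib_left[symmetric] using N by (intro mult_left_mono norm_sum) auto
  ultimately show "N * norm (peval f z - lead_form f z)
      \<le> (\<Sum>m\<in>Poly_Mapping.keys f. norm (Poly_Mapping.lookup f m)) * N ^ ?d"
    by (simp add: sum_distrib_right)
qed

text \<open>Here \<open>u = z\<^sub>0\<close> and \<open>x = z\<^sub>1\<close> are fixed and \<open>z\<^sub>2\<close> is the polynomial variable. Keeping \<open>u\<close> treats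
  \<open>f\<close> (\<open>u = 1\<close>) and its leading form (\<open>u = 0\<close>) at the same time.\<close>

definition section_poly :: "2 cpoly \<Rightarrow> complex \<Rightarrow> complex \<Rightarrow> complex poly" where
  "section_poly f u x = (\<Sum>m\<in>Poly_Mapping.keys f. Polynomial.monom (Poly_Mapping.lookup f m *
      u ^ (total_degree f - mon_degree m) * x ^ Poly_Mapping.lookup m 1) (Poly_Mapping.lookup m 2))"

lemma mon_degree_2: "mon_degree (m :: 2 \<Rightarrow>\<^sub>0 nat) = Poly_Mapping.lookup m 1 + Poly_Mapping.lookup m 2"
  by (simp add: mon_degree_def UNIV_2)

lemma poly_section_poly:
  "poly (section_poly f u x) t = peval (homogenization f) (hom_coords u (vector [x, t]))"
  by (simp add: section_poly_def peval_homogenization poly_sum poly_monom UNIV_2 mult_ac)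

lemma poly_section_poly_0: "poly (section_poly f 0 x) t = lead_form f (vector [x, t])"
  by (simp add: poly_section_poly lead_form_def)

lemma poly_section_poly_1: "poly (section_poly f 1 x) t = peval f (vector [x, t])"
  using peval_homogenization_affine[of 1 f "vector [x, t]"] by (simp add: poly_section_poly)

lemma degree_section_poly: "degree (section_poly f u x) \<le> total_degree f"
  unfolding section_poly_def
proof (intro degree_sum_le)
  fix m assume "m \<in> Poly_Mapping.keys f"
  then have "Poly_Mapping.lookup m 2 \<le> total_degree f"
    using mon_degree_le_total_degree[of m f] by (simp add: mon_degree_2)
  then show "degree (Polynomial.monom (Poly_Mapping.lookup f m * u ^ (total_degree f - mon_degree m) *
     x ^ Poly_Mapping.lookup m 1) (Poly_Mapping.lookup m 2)) \<le> total_degree f"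
    using degree_monom_le order_trans by blast
qed simp

text \<open>A monomial whose exponent of \<open>z2\<close> already equals the total degree contains
  neither \<open>z0\<close> nor \<open>z1\<close>. So this coefficient does not depend on
  \<open>u\<close> and \<open>x\<close>, which makes root estimates uniform over all
  sections.\<close>

lemma coeff_section_poly:
  "coeff (section_poly f u x) (total_degree f) = lead_form f (vector [0, 1])"
  unfolding section_poly_def coeff_sum lead_form_eq
proof (intro sum.cong refl)
  fix m assume "m \<in> Poly_Mapping.keys f"
  then have "mon_degree m \<le> total_degree f"
    by (rule mon_degree_le_total_degree)
  then show "coeff (Polynomial.monom (Poly_Mapping.lookup f m * u ^ (total_degree f - mon_degree m) *
       x ^ Poly_Mapping.lookup m 1) (Poly_Mapping.lookup m 2)) (total_degree f) =
     Poly_Mapping.lookup f m * 0 ^ (total_degree f - mon_degree m) *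
       (\<Prod>i\<in>UNIV. vector [0, 1] $ i ^ Poly_Mapping.lookup m i)"
    by (auto simp: UNIV_2 mon_degree_2 power_0_left)
qed

lemma poly_section_poly_degree_0:
  assumes "total_degree f = 0"
  shows "poly (section_poly f u x) t = lead_form f (vector [0, 1])"
proof -
  have "degree (section_poly f u x) = 0"
    using degree_section_poly[of f u x] assms by simp
  then obtain b where "section_poly f u x = [:b:]"
    by (rule degree_eq_zeroE)
  then show ?thesis
    using coeff_section_poly[of f u x] assms by simp
qed

section \<open>Limit directions from roots of the leading form\<close>

text \<open>The definition wants points exactly on the sphere, so the radii \<open>Suc k\<close> are
  replaced by \<open>norm (y k)\<close>. The quotient of the two tends to 1, so these radii also
  tend to infinity and the limit stays the same.\<close>

lemma limit_directionsI:
  assumes y: "\<And>k. y k \<in> imaginary_projection f"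
    and lim: "(\<lambda>k. (1 / real (Suc k)) *\<^sub>R y k) \<longlonglongrightarrow> v" and v: "norm v = 1"
  shows "v \<in> limit_directions f"
proof -
  let ?w = "\<lambda>k. (1 / real (Suc k)) *\<^sub>R y k"
  have nw: "(\<lambda>k. norm (?w k)) \<longlonglongrightarrow> 1"
    using tendsto_norm[OF lim] v by simp
  then have "\<forall>\<^sub>F k in sequentially. 0 < norm (?w k)"
    by (rule order_tendstoD) simp
  \<comment> \<open>The shift by \<open>K\<close> discards the indices where \<open>y k\<close>
    might vanish and could not be normalized.\<close>
  then obtain K where K: "\<And>k. k \<ge> K \<Longrightarrow> y k \<noteq> 0"
    unfolding eventually_sequentially by force
  have "filterlim (\<lambda>k. real (Suc k)) at_top sequentially"
    using filterlim_compose[OF filterlim_real_sequentially filterlim_Suc] .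
  from filterlim_tendsto_pos_mult_at_top[OF nw _ this]
  have "filterlim (\<lambda>k. norm (y k)) at_top sequentially"
    by simp
  then have 1: "filterlim (\<lambda>k. norm (y (k + K))) at_top sequentially"
    using filterlim_compose[OF _ filterlim_add_const_nat_at_top[of K]] by blast
  have "(\<lambda>k. ?w k /\<^sub>R norm (?w k)) \<longlonglongrightarrow> v /\<^sub>R 1"
    using nw lim by (intro tendsto_intros) auto
  moreover have "?w k /\<^sub>R norm (?w k) = (1 / norm (y k)) *\<^sub>R y k" for k
    by (simp add: field_simps)
  ultimately have "(\<lambda>k. (1 / norm (y k)) *\<^sub>R y k) \<longlonglongrightarrow> v"
    by simp
  from LIMSEQ_ignore_initial_segment[OF this, of K]
  have 2: "(\<lambda>k. (1 / norm (y (k + K))) *\<^sub>R y (k + K)) \<longlonglongrightarrow> v" .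
  have 3: "(1 / norm (y (k + K))) *\<^sub>R y (k + K) \<in>
      (\<lambda>x. (1 / norm (y (k + K))) *\<^sub>R x) ` imaginary_projection f \<inter> sphere 0 1" for k
    using y K[of "k + K"] by auto
  show ?thesis
    unfolding limit_directions_def mem_Collect_eq
    using 1 2 3 by (intro exI[of _ "\<lambda>k. norm (y (k + K))"] exI conjI allI)
qed

lemma limit_directions_subset_sphere: "limit_directions f \<subseteq> sphere 0 1"
proof
  fix p assume "p \<in> limit_directions f"
  then obtain q where "\<And>k::nat. q k \<in> sphere 0 1" "q \<longlonglongrightarrow> p"
    unfolding limit_directions_def by blast
  then show "p \<in> sphere 0 1"
    using closed_sequentially[OF closed_sphere] by blast
qed


text \<open>The section through \<open>n * s\<close> has the same leading coefficient
  \<open>c\<close> for every \<open>n\<close>, so \<open>poly_root_near\<close> turns a value of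
  order \<open>n^(d-1)\<close> at \<open>n * a * s\<close> into a root \<open>t\<close> with
  \<open>norm (a * s - t / n) ^ d\<close> of order \<open>1 / n\<close>. The number \<open>s\<close>
  stays free so that both cases of the theorem can choose it.\<close>

lemma lead_form_root_limit_direction:
  fixes f :: "2 cpoly" and a s :: complex
  assumes c: "lead_form f (vector [0, 1]) \<noteq> 0" and a: "lead_form f (vector [1, a]) = 0"
    and s: "norm (vector [Im s, Im (a * s)] :: real ^ 2) = 1"
  shows "vector [Im s, Im (a * s)] \<in> limit_directions f"
proof -
  define d c where "d = total_degree f" and "c = lead_form f (vector [0, 1])"
  have deg: "degree (section_poly f u x) = d" "lead_coeff (section_poly f u x) = c" for u x
    using degree_section_poly[of f u x] coeff_section_poly[of f u x] c le_degree[of "section_poly f u x" d]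
    by (auto simp: d_def c_def)
  have "d \<noteq> 0"
  proof
    assume "d = 0"
    then have "lead_form f (vector [1, a]) = c"
      using poly_section_poly_degree_0[of f 0 1 a] by (simp add: poly_section_poly_0 d_def c_def)
    then show False
      using a c by (simp add: c_def)
  qed
  then obtain d' where d': "d = Suc d'"
    using not0_implies_Suc by blast
  obtain M where M: "\<forall>z N. 1 \<le> N \<longrightarrow> (\<forall>i. norm (z $ i) \<le> N) \<longrightarrow>
      N * norm (peval f z - lead_form f z) \<le> M * N ^ d"
    using peval_lead_form_bound[of f, folded d_def] ..
  \<comment> \<open>\<open>B\<close> dominates both coordinates of \<open>(s, a * s)\<close>; the
    summand 1 ensures \<open>n * B >= 1\<close>, as the bound with \<open>M\<close>
    requires.\<close>
  define B where "B = norm s * (1 + norm a) + 1"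
  have B: "norm s \<le> B" "norm (a * s) \<le> B" "1 \<le> B"
    by (auto simp: B_def algebra_simps norm_mult)
  define C where "C = M * B ^ d / (norm c * B)"
  have "\<exists>t. peval f (vector [of_nat (Suc k) * s, t]) = 0 \<and>
      (norm (a * s - t / of_nat (Suc k))) ^ d \<le> C / real (Suc k)" for k
  proof -
    define n where "n = real (Suc k)"
    have n: "n \<ge> 1" by (simp add: n_def)
    let ?p = "section_poly f 1 (of_real n * s)"
    let ?x = "of_real n * (a * s)"
    obtain t where t: "poly ?p t = 0" "norm c * norm (?x - t) ^ d \<le> norm (poly ?p ?x)"
      using poly_root_near[of ?p d' ?x] deg[of 1 "of_real n * s"] d' by auto
    have "vector [of_real n * s, ?x] = (of_real n * s) *s (vector [1, a] :: complex ^ 2)"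
      by (simp add: vec_eq_iff forall_2)
    then have "lead_form f (vector [of_real n * s, ?x]) = 0"
      using a by (simp add: lead_form_scale)
    moreover have "norm (vector [of_real n * s, ?x] $ i) \<le> n * B" for i :: 2
      using B n exhaust_2[of i] by (auto simp: norm_mult)
    moreover have "1 \<le> n * B"
      using mult_mono[OF n B(3)] n by simp
    ultimately have "n * B * norm (peval f (vector [of_real n * s, ?x])) \<le> M * (n * B) ^ d"
      using M[rule_format, of "n * B" "vector [of_real n * s, ?x]"] by simp
    then have "n * B * norm (poly ?p ?x) \<le> M * (n * B) ^ d"
      by (simp add: poly_section_poly_1)
    then have "n * B * (norm c * norm (?x - t) ^ d) \<le> M * (n * B) ^ d"
      using t(2) n B(3) mult_left_mono[of _ _ "n * B"] by (meson order_trans mult_nonneg_nonneg zero_le_one)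
    moreover have "?x - t = of_real n * (a * s - t / of_real n)"
      using n by (simp add: field_simps)
    then have "norm (?x - t) ^ d = n ^ d * norm (a * s - t / of_real n) ^ d"
      using n by (simp add: norm_mult power_mult_distrib)
    ultimately have "n ^ d * (n * B * (norm c * norm (a * s - t / of_real n) ^ d)) \<le> n ^ d * (M * B ^ d)"
      by (simp add: power_mult_distrib mult_ac)
    then have "n * B * (norm c * norm (a * s - t / of_real n) ^ d) \<le> M * B ^ d"
      using n by simp
    then have "norm (a * s - t / of_real n) ^ d \<le> C / n"
      using n B c by (simp add: C_def c_def field_simps)
    then show ?thesis
      using t(1) by (intro exI[of _ t]) (simp add: n_def poly_section_poly_1 of_real_of_nat_eq)
  qed
  then obtain t where t: "\<And>k. peval f (vector [of_nat (Suc k) * s, t k]) = 0"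
      "\<And>k. norm (a * s - t k / of_nat (Suc k)) ^ d \<le> C / real (Suc k)"
    by metis
  have "(\<lambda>k. C / real (Suc k)) \<longlonglongrightarrow> 0"
    using LIMSEQ_Suc[OF lim_const_over_n[of C]] by simp
  then have "(\<lambda>k. norm (a * s - t k / of_nat (Suc k)) ^ d) \<longlonglongrightarrow> 0"
    by (rule tendsto_sandwich[rotated 3]) (use t(2) in auto)
  then have "(\<lambda>k. root d (norm (a * s - t k / of_nat (Suc k)) ^ d)) \<longlonglongrightarrow> root d 0"
    by (rule tendsto_real_root)
  then have "(\<lambda>k. norm (a * s - t k / of_nat (Suc k))) \<longlonglongrightarrow> 0"
    using \<open>d \<noteq> 0\<close> by (simp add: real_root_power_cancel)
  then have "(\<lambda>k. a * s - (a * s - t k / of_nat (Suc k))) \<longlonglongrightarrow> a * s - 0"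
    by (intro tendsto_diff tendsto_const) (rule tendsto_norm_zero_cancel)
  then have "(\<lambda>k. Im (t k / of_nat (Suc k))) \<longlonglongrightarrow> Im (a * s)"
    by (intro tendsto_Im) simp
  then have lim: "(\<lambda>k. vector [Im s, Im (t k / of_nat (Suc k))] :: real ^ 2)
      \<longlonglongrightarrow> vector [Im s, Im (a * s)]"
  proof (intro vec_tendstoI)
    fix i :: 2
    show "(\<lambda>k. vector [Im s, Im (t k / of_nat (Suc k))] $ i) \<longlonglongrightarrow> vector [Im s, Im (a * s)] $ i"
      using exhaust_2[of i] \<open>(\<lambda>k. Im (t k / of_nat (Suc k))) \<longlonglongrightarrow> _\<close> by auto
  qed
  show ?thesis
  proof (rule limit_directionsI[OF _ _ s])
    show "vector [Im (of_nat (Suc k) * s), Im (t k)] \<in> imaginary_projection f" for k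
      unfolding imaginary_projection_def mem_Collect_eq
      by (intro exI[of _ "vector [of_nat (Suc k) * s, t k]"])
        (use t(1)[of k] in \<open>simp add: vec_eq_iff forall_2\<close>)
    have "(1 / real (Suc k)) *\<^sub>R vector [Im (of_nat (Suc k) * s), Im (t k)] =
        (vector [Im s, Im (t k / of_nat (Suc k))] :: real ^ 2)" for k
      by (simp add: vec_eq_iff forall_2 Im_divide_of_nat del: of_nat_Suc)
    then show "(\<lambda>k. (1 / real (Suc k)) *\<^sub>R vector [Im (of_nat (Suc k) * s), Im (t k)])
        \<longlonglongrightarrow> (vector [Im s, Im (a * s)] :: real ^ 2)"
      using lim by simp
  qed
qed

section \<open>Excluding other directions when all roots are real and distinct\<close>

text \<open>For \<open>x = 1\<close> both sides are polynomials in \<open>t\<close> of degree at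
  most \<open>d\<close> with the same coefficient at \<open>d\<close>, and they agree at
  \<open>d\<close> distinct points. Homogeneity carries the identity over to all
  \<open>x\<close>.\<close>

lemma lead_form_factorization:
  fixes f :: "2 cpoly"
  assumes inj: "inj_on a {1..total_degree f}"
    and a: "\<And>j. j \<in> {1..total_degree f} \<Longrightarrow> lead_form f (vector [1, a j]) = 0"
  shows "lead_form f (vector [x, t]) =
    lead_form f (vector [0, 1]) * (\<Prod>j\<in>{1..total_degree f}. t - a j * x)"
proof -
  define d c where "d = total_degree f" and "c = lead_form f (vector [0, 1])"
  define q where "q = smult c (\<Prod>j\<in>{1..d}. [:- a j, 1:])"
  have dq: "degree (\<Prod>j\<in>{1..d}. [:- a j, 1:]) = d"
    by (subst degree_prod_eq_sum_degree) auto
  have "section_poly f 0 1 = q"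
  proof (rule poly_eqI_degree_lead_coeff[where n = d and A = "a ` {1..d}"])
    have "coeff (\<Prod>j\<in>{1..d}. [:- a j, 1:]) d = 1"
      using lead_coeff_prod[of "\<lambda>j. [:- a j, 1:]" "{1..d}"] dq by simp
    then show "coeff (section_poly f 0 1) d = coeff q d"
      using coeff_section_poly[of f 0 1] by (simp add: d_def c_def q_def)
    show "poly (section_poly f 0 1) z = poly q z" if "z \<in> a ` {1..d}" for z
    proof -
      from that obtain j where j: "j \<in> {1..d}" "z = a j"
        by blast
      then have "(\<Prod>i\<in>{1..d}. z - a i) = 0"
        by (intro prod_zero) auto
      then show ?thesis
        using a j by (simp add: q_def d_def poly_section_poly_0 poly_prod)
    qed
    show "degree (section_poly f 0 1) \<le> d"
      using degree_section_poly by (simp add: d_def)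
    show "degree q \<le> d"
      using dq degree_smult_le[of c] by (simp add: q_def)
    show "d \<le> card (a ` {1..d})"
      using inj by (simp add: card_image d_def)
  qed
  then have 1: "lead_form f (vector [1, t]) = c * (\<Prod>j\<in>{1..d}. t - a j)" for t
    by (simp add: poly_section_poly_0[symmetric] q_def poly_prod)
  show ?thesis
  proof (cases "x = 0")
    case True
    have "vector [0, t] = t *s (vector [0, 1] :: complex ^ 2)"
      by (simp add: vec_eq_iff forall_2)
    then have "lead_form f (vector [0, t]) = t ^ d * c"
      by (simp add: lead_form_scale d_def c_def)
    then show ?thesis
      using True by (simp add: d_def c_def)
  next
    case False
    then have "vector [x, t] = x *s (vector [1, t / x] :: complex ^ 2)"
      by (simp add: vec_eq_iff forall_2)
    then have "lead_form f (vector [x, t]) = x ^ d * (c * (\<Prod>j\<in>{1..d}. t / x - a j))"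
      by (simp add: lead_form_scale d_def 1)
    also have "\<dots> = c * (\<Prod>j\<in>{1..d}. x * (t / x - a j))"
      by (simp add: prod.distrib)
    also have "\<dots> = c * (\<Prod>j\<in>{1..d}. t - a j * x)"
      using False by (intro arg_cong2[of _ _ _ _ "(*)"] prod.cong) (auto simp: field_simps)
    finally show ?thesis
      by (simp add: d_def c_def)
  qed
qed

text \<open>Two linear forms with different slopes are coordinates of the plane, so the larger of
  them controls both \<open>x\<close> and \<open>t\<close>. Consequently all forms except a smallest
  one are comparable to the size of \<open>(x, t)\<close>.\<close>

lemma linear_forms_separated:
  fixes a :: "'i \<Rightarrow> complex"
  assumes "finite A" "inj_on a A"
  obtains K where "K > 0"
    "\<And>i j x t. i \<in> A \<Longrightarrow> j \<in> A \<Longrightarrow> i \<noteq> j \<Longrightarrow> norm (t - a j * x) \<le> norm (t - a i * x) \<Longrightarrow>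
       max (norm x) (norm t) \<le> K * norm (t - a i * x)"
proof
  \<comment> \<open>The sum of the two bounds derived below, for \<open>norm x\<close> and for
    \<open>norm t\<close>, as a multiple of the larger form.\<close>
  define \<kappa> where "\<kappa> = (\<lambda>(i, j). 1 + 2 * (norm (a i) + 1) / norm (a i - a j))"
  have pos: "\<kappa> ij \<ge> 0" for ij
    by (auto simp: \<kappa>_def split: prod.splits)
  \<comment> \<open>Summing over all pairs gives one constant for all of them; the summand 1 keeps
    it positive even for empty \<open>A\<close>.\<close>
  define K where "K = 1 + (\<Sum>ij\<in>A \<times> A. \<kappa> ij)"
  show "K > 0"
    using sum_nonneg[of "A \<times> A" \<kappa>] pos by (simp add: K_def add_pos_nonneg)
  fix i j x t
  assume ij: "i \<in> A" "j \<in> A" "i \<noteq> j" and le: "norm (t - a j * x) \<le> norm (t - a i * x)"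
  let ?l = "norm (t - a i * x)"
  have D: "norm (a i - a j) > 0"
    using assms(2) ij by (auto dest: inj_onD)
  have "norm (a i - a j) * norm x = norm ((t - a j * x) - (t - a i * x))"
    by (simp add: norm_mult[symmetric] algebra_simps)
  also have "\<dots> \<le> 2 * ?l"
    using norm_triangle_ineq4[of "t - a j * x" "t - a i * x"] le by simp
  finally have x: "norm x \<le> 2 * ?l / norm (a i - a j)"
    using D by (simp add: field_simps)
  have "norm t \<le> ?l + norm (a i) * norm x"
    using norm_triangle_ineq[of "t - a i * x" "a i * x"] by (simp add: norm_mult)
  also have "\<dots> \<le> ?l + norm (a i) * (2 * ?l / norm (a i - a j))"
    using x by (intro add_left_mono mult_left_mono) auto
  finally have t: "norm t \<le> ?l + norm (a i) * (2 * ?l / norm (a i - a j))" .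
  have "\<kappa> (i, j) * ?l = ?l + norm (a i) * (2 * ?l / norm (a i - a j)) + 2 * ?l / norm (a i - a j)"
    by (simp add: \<kappa>_def algebra_simps add_divide_distrib)
  moreover have "0 \<le> 2 * ?l / norm (a i - a j)" "0 \<le> norm (a i) * (2 * ?l / norm (a i - a j))"
    by auto
  ultimately have "max (norm x) (norm t) \<le> \<kappa> (i, j) * ?l"
    using x t norm_ge_zero[of "t - a i * x"] by linarith
  also have "\<kappa> (i, j) \<le> (\<Sum>ij\<in>A \<times> A. \<kappa> ij)"
    using assms(1) ij pos by (intro member_le_sum) auto
  then have "\<kappa> (i, j) * ?l \<le> K * ?l"
    by (intro mult_right_mono) (auto simp: K_def)
  finally show "max (norm x) (norm t) \<le> K * ?l" .
qed

lemma limit_direction_real_roots: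
  fixes f :: "2 cpoly" and \<alpha> :: "nat \<Rightarrow> real"
  assumes c: "lead_form f (vector [0, 1]) \<noteq> 0"
    and inj: "inj_on \<alpha> {1..total_degree f}"
    and \<alpha>: "\<And>j. j \<in> {1..total_degree f} \<Longrightarrow> lead_form f (vector [1, of_real (\<alpha> j)]) = 0"
    and p: "p \<in> limit_directions f"
  shows "\<exists>j\<in>{1..total_degree f}. p $ 2 = \<alpha> j * p $ 1"
proof (rule ccontr)
  define d c where "d = total_degree f" and "c = lead_form f (vector [0, 1])"
  define a where "a j = complex_of_real (\<alpha> j)" for j
  define l where "l j q = \<bar>q $ 2 - \<alpha> j * q $ 1\<bar>" for j and q :: "real ^ 2"
  assume "\<not> ?thesis"
  then have lp: "l j p > 0" if "j \<in> {1..d}" for j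
    using that by (auto simp: l_def d_def)
  obtain r q where r: "filterlim r at_top sequentially" and q: "q \<longlonglongrightarrow> p"
    and rq: "\<And>k::nat. q k \<in> (\<lambda>y. (1 / r k) *\<^sub>R y) ` imaginary_projection f \<inter> sphere 0 1"
    using p unfolding limit_directions_def by blast
  have "d \<noteq> 0"
  proof
    assume d0: "d = 0"
    have "peval f z = c" for z
    proof -
      have "vector [z $ 1, z $ 2] = z"
        by (simp add: vec_eq_iff forall_2)
      then show ?thesis
        using poly_section_poly_degree_0[of f 1 "z $ 1" "z $ 2"] d0
        by (simp add: poly_section_poly_1 d_def c_def)
    qed
    then have "imaginary_projection f = {}"
      using c by (simp add: imaginary_projection_def c_def)
    then show False
      using rq by simp
  qed
  obtain M where M: "\<forall>z N. 1 \<le> N \<longrightarrow> (\<forall>i. norm (z $ i) \<le> N) \<longrightarrow>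
      N * norm (peval f z - lead_form f z) \<le> M * N ^ d"
    using peval_lead_form_bound[of f, folded d_def] ..
  have "inj_on a {1..d}"
    using inj unfolding inj_on_def a_def d_def of_real_eq_iff .
  then obtain K where K: "K > 0"
    "\<And>i j x t. i \<in> {1..d} \<Longrightarrow> j \<in> {1..d} \<Longrightarrow> i \<noteq> j \<Longrightarrow> norm (t - a j * x) \<le> norm (t - a i * x) \<Longrightarrow>
       max (norm x) (norm t) \<le> K * norm (t - a i * x)"
    using linear_forms_separated[of "{1..d}" a] by blast
  \<comment> \<open>Half the minimum leaves room for the passage from \<open>p\<close> to
    \<open>q k\<close> with large \<open>k\<close>.\<close>
  define \<delta> where "\<delta> = Min ((\<lambda>j. l j p) ` {1..d}) / 2"
  have "\<delta> > 0"
    using lp \<open>d \<noteq> 0\<close> by (simp add: \<delta>_def)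
  have \<delta>: "\<delta> < l j p" if "j \<in> {1..d}" for j
  proof -
    have "Min ((\<lambda>j. l j p) ` {1..d}) \<le> l j p"
      using that by simp
    then show ?thesis
      using \<open>\<delta> > 0\<close> by (simp add: \<delta>_def)
  qed
  \<comment> \<open>The bound on \<open>r k\<close> that results from comparing the lower and upper
    estimates of the leading form at the end.\<close>
  define R where "R = M * K ^ (d - 1) / (norm c * \<delta>)"
  have "\<forall>\<^sub>F k in sequentially. \<delta> < l j (q k)" if "j \<in> {1..d}" for j
    by (rule order_tendstoD(1)[OF _ \<delta>[OF that]]) (use q in \<open>auto simp: l_def intro!: tendsto_intros\<close>)
  then have "\<forall>\<^sub>F k in sequentially. \<forall>j\<in>{1..d}. \<delta> < l j (q k)"
    by (intro eventually_ball_finite) auto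
  \<comment> \<open>The bound 2 is what gives \<open>1 <= N\<close> below, since
    \<open>r k <= 2 * N\<close>.\<close>
  moreover have "\<forall>\<^sub>F k in sequentially. max 2 R < r k"
    using r unfolding filterlim_at_top_dense by blast
  ultimately have "\<forall>\<^sub>F k in sequentially. (\<forall>j\<in>{1..d}. \<delta> < l j (q k)) \<and> max 2 R < r k"
    by (rule eventually_conj)
  then obtain k where l: "\<And>j. j \<in> {1..d} \<Longrightarrow> \<delta> < l j (q k)" and rk: "2 < r k" "R < r k"
    unfolding eventually_sequentially by force
  obtain z where z: "q k = (1 / r k) *\<^sub>R (\<chi> i. Im (z $ i))" "peval f z = 0" and nq: "norm (q k) = 1"
    using rq[of k] by (auto simp: imaginary_projection_def)
  define x t N where "x = z $ 1" and "t = z $ 2" and "N = max (norm (z $ 1)) (norm (z $ 2))"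
  have im: "Im x = r k * q k $ 1" "Im t = r k * q k $ 2"
    using z(1) rk by (simp_all add: x_def t_def)
  have zxt: "z = vector [x, t]"
    by (simp add: vec_eq_iff forall_2 x_def t_def)
  have "1 \<le> \<bar>q k $ 1\<bar> + \<bar>q k $ 2\<bar>"
    using norm_le_l1_cart[of "q k"] nq by (simp add: sum_2)
  then have "r k * 1 \<le> r k * (\<bar>q k $ 1\<bar> + \<bar>q k $ 2\<bar>)"
    using rk by (intro mult_left_mono) auto
  also have "\<dots> = \<bar>Im x\<bar> + \<bar>Im t\<bar>"
    using rk by (simp add: im abs_mult distrib_left)
  also have "\<dots> \<le> N + N"
    using abs_Im_le_cmod[of x] abs_Im_le_cmod[of t] by (intro add_mono) (auto simp: N_def x_def t_def)
  finally have N: "1 \<le> N"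
    using rk by simp
  have "norm (z $ i) \<le> N" for i
    using exhaust_2[of i] by (auto simp: N_def)
  from M[rule_format, OF N this] have "N * norm (lead_form f z) \<le> M * N ^ d"
    using z(2) by simp
  then have upper: "N * (norm c * (\<Prod>i\<in>{1..d}. norm (t - a i * x))) \<le> M * N ^ d"
    using lead_form_factorization[of a f x t] \<open>inj_on a {1..d}\<close> \<alpha>
    by (simp add: zxt d_def c_def a_def norm_mult prod_norm)
  have low: "\<delta> * r k \<le> norm (t - a i * x)" if "i \<in> {1..d}" for i
  proof -
    have "\<delta> * r k \<le> l i (q k) * r k"
      using l[OF that] rk by (intro mult_right_mono) auto
    also have "\<dots> = \<bar>Im (t - a i * x)\<bar>"
    proof -
      \<comment> \<open>Here the slopes have to be real: the imaginary part of the form is then the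
        same form applied to the imaginary parts.\<close>
      have "Im (t - a i * x) = (q k $ 2 - \<alpha> i * q k $ 1) * r k"
        by (simp add: a_def im algebra_simps)
      then show ?thesis
        using rk by (simp add: l_def abs_mult)
    qed
    also have "\<dots> \<le> norm (t - a i * x)"
      by (rule abs_Im_le_cmod)
    finally show ?thesis .
  qed
  \<comment> \<open>The smallest factor \<open>j\<close> is bounded below only by
    \<open>\<delta> * r k\<close>; each of the other \<open>d - 1\<close> factors is at least
    \<open>N / K\<close>.\<close>
  obtain j where j: "j \<in> {1..d}" "\<And>i. i \<in> {1..d} \<Longrightarrow> norm (t - a j * x) \<le> norm (t - a i * x)"
    using ex_is_arg_min_if_finite[of "{1..d}" "\<lambda>i. norm (t - a i * x)"] \<open>d \<noteq> 0\<close>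
    by (auto simp: is_arg_min_linorder)
  have other: "0 \<le> N / K \<and> N / K \<le> norm (t - a i * x)" if i: "i \<in> {1..d} - {j}" for i
  proof -
    have "max (norm x) (norm t) \<le> K * norm (t - a i * x)"
      using K(2)[of i j t x] i j by blast
    then have "N \<le> norm (t - a i * x) * K"
      by (simp only: N_def x_def t_def mult.commute)
    then show ?thesis
      using K(1) N by (simp add: pos_divide_le_eq)
  qed
  have "(N / K) ^ (d - 1) = (\<Prod>i\<in>{1..d} - {j}. N / K)"
    using j(1) by simp
  also have "\<dots> \<le> (\<Prod>i\<in>{1..d} - {j}. norm (t - a i * x))"
    by (intro prod_mono other)
  finally have "\<delta> * r k * (N / K) ^ (d - 1) \<le>
      norm (t - a j * x) * (\<Prod>i\<in>{1..d} - {j}. norm (t - a i * x))"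
    using low[OF j(1)] K(1) N by (intro mult_mono) (simp_all add: prod_nonneg)
  also have "\<dots> = (\<Prod>i\<in>{1..d}. norm (t - a i * x))"
    using j(1) by (intro prod.remove[symmetric]) auto
  finally have "N * (norm c * (\<delta> * r k * (N / K) ^ (d - 1))) \<le>
      N * (norm c * (\<Prod>i\<in>{1..d}. norm (t - a i * x)))"
    using N by (intro mult_left_mono) auto
  also note upper
  finally have "N * (norm c * (\<delta> * r k * (N / K) ^ (d - 1))) \<le> M * N ^ d"
    .
  \<comment> \<open>Cancelling first \<open>N\<close> and then \<open>N ^ (d - 1)\<close> leaves a
    bound on \<open>r k\<close> that is independent of \<open>z\<close>.\<close>
  also have "M * N ^ d = N * (N ^ (d - 1) * M)"
    using \<open>d \<noteq> 0\<close> by (cases d) auto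
  finally have "norm c * (\<delta> * r k * (N / K) ^ (d - 1)) \<le> N ^ (d - 1) * M"
    using N by (subst (asm) mult_le_cancel_left_pos) auto
  also have "norm c * (\<delta> * r k * (N / K) ^ (d - 1)) = N ^ (d - 1) * (norm c * (\<delta> * r k / K ^ (d - 1)))"
    by (simp add: power_divide)
  finally have "norm c * (\<delta> * r k / K ^ (d - 1)) \<le> M"
    using N by (subst (asm) mult_le_cancel_left_pos) auto
  then have "r k \<le> R"
    using K(1) \<open>\<delta> > 0\<close> c by (simp add: R_def c_def field_simps)
  then show False
    using rk by simp
qed

section \<open>Zeros at infinity and the two cases of the theorem\<close>

lemma proj_point_self: "z \<in> proj_point z"
  unfolding proj_point_def by (auto intro!: exI[of _ 1])

text \<open>The representative \<open>w\<close> supplied by \<open>zeros_at_infinity\<close> may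
  differ from \<open>hom_coords 0 z\<close> by a scalar, which homogeneity of the leading form
  absorbs.\<close>

lemma lead_form_eq_0_iff:
  assumes "z \<noteq> 0"
  shows "lead_form f z = 0 \<longleftrightarrow> proj_point (hom_coords 0 z) \<in> zeros_at_infinity f"
proof
  have "hom_coords 0 z \<noteq> 0"
  proof
    assume "hom_coords 0 z = 0"
    then have "z $ i = 0" for i
      by (metis hom_coords_def option.simps(5) vec_lambda_beta zero_index)
    with assms show False by (simp add: vec_eq_iff)
  qed
  moreover assume "lead_form f z = 0"
  ultimately show "proj_point (hom_coords 0 z) \<in> zeros_at_infinity f"
    unfolding zeros_at_infinity_def lead_form_def by (auto simp: hom_coords_def)
next
  assume "proj_point (hom_coords 0 z) \<in> zeros_at_infinity f"
  then obtain w where w: "w $ None = 0" "peval (homogenization f) w = 0"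
    and eq: "proj_point (hom_coords 0 z) = proj_point w"
    unfolding zeros_at_infinity_def by auto
  obtain k where k: "hom_coords 0 z = k *s w"
    using proj_point_self[of "hom_coords 0 z"] unfolding eq by (auto simp: proj_point_def)
  define v where "v = (\<chi> i. w $ Some i)"
  have "w = hom_coords 0 v"
    using w(1) by (auto simp: vec_eq_iff hom_coords_def v_def split: option.splits)
  then have v: "lead_form f v = 0"
    using w(2) by (simp add: lead_form_def)
  have "z $ i = (k *s v) $ i" for i
    using arg_cong[OF k, of "\<lambda>u. u $ Some i"] by (simp add: hom_coords_def v_def)
  then have "z = k *s v"
    by (simp add: vec_eq_iff)
  then show "lead_form f z = 0"
    using v by (simp add: lead_form_scale)
qed

theorem corollary6p7:
  fixes f :: "2 cpoly" and d :: nat and a :: "nat \<Rightarrow> complex"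
  assumes "total_degree f = d"
    and "zeros_at_infinity f = (\<lambda>j. proj_point (hom_coords 0 (vector [1, a j]))) ` {1..d}"
    and "(\<forall>j\<in>{1..d}. a j \<in> \<real>) \<longrightarrow> inj_on a {1..d}"
  shows "limit_directions f =
    (if \<forall>j\<in>{1..d}. a j \<in> \<real>
     then \<Union>j\<in>{1..d}.
       {(1 / sqrt (1 + (Re (a j))\<^sup>2)) *\<^sub>R vector [1, Re (a j)],
        - ((1 / sqrt (1 + (Re (a j))\<^sup>2)) *\<^sub>R vector [1, Re (a j)])}
     else sphere 0 1)"
proof -
  have root: "lead_form f (vector [1, a j]) = 0" if "j \<in> {1..d}" for j
  proof -
    have "vector [1, a j] \<noteq> (0 :: complex ^ 2)"
      by (simp add: vec_eq_iff forall_2)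
    then show ?thesis
      using that assms(2) by (simp add: lead_form_eq_0_iff)
  qed
  \<comment> \<open>The point \<open>(0:0:1)\<close> is not among the listed zeros, as their
    \<open>z1\<close> coordinate is nonzero.\<close>
  have c: "lead_form f (vector [0, 1]) \<noteq> 0"
  proof
    assume "lead_form f (vector [0, 1]) = 0"
    moreover have "vector [0, 1] \<noteq> (0 :: complex ^ 2)"
      by (simp add: vec_eq_iff forall_2)
    ultimately obtain j where
      j: "proj_point (hom_coords 0 (vector [0, 1])) = proj_point (hom_coords 0 (vector [1, a j] :: complex ^ 2))"
      using assms(2) lead_form_eq_0_iff[of "vector [0, 1]" f] by auto
    obtain k where "hom_coords 0 (vector [1, a j] :: complex ^ 2) = k *s hom_coords 0 (vector [0, 1])"
      using proj_point_self[of "hom_coords 0 (vector [1, a j] :: complex ^ 2)"]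
      unfolding j[symmetric] by (auto simp: proj_point_def)
    from arg_cong[OF this, of "\<lambda>u. u $ Some 1"] show False
      by (simp add: hom_coords_def)
  qed
  have norm2: "norm (vector [u, v] :: real ^ 2) = sqrt (u\<^sup>2 + v\<^sup>2)" for u v
    by (simp add: norm_vec_def L2_set_def sum_2)
  show ?thesis
  proof (cases "\<forall>j\<in>{1..d}. a j \<in> \<real>")
    case True
    have a: "complex_of_real (Re (a j)) = a j" if "j \<in> {1..d}" for j
      using True that by (simp add: of_real_Re)
    define v where "v j = (1 / sqrt (1 + (Re (a j))\<^sup>2)) *\<^sub>R (vector [1, Re (a j)] :: real ^ 2)" for j
    have "\<exists>j\<in>{1..d}. p = v j \<or> p = - v j" if p: "p \<in> limit_directions f" for p
    proof -
      have "inj_on (\<lambda>j. Re (a j)) {1..d}"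
        using assms(3) True a by (metis (mono_tags, lifting) inj_on_def)
      then obtain j where j: "j \<in> {1..d}" "p $ 2 = Re (a j) * p $ 1"
        using limit_direction_real_roots[OF c _ _ p, of "\<lambda>j. Re (a j)"] root a assms(1) by auto
      define s where "s = sqrt (1 + (Re (a j))\<^sup>2)"
      have s: "s > 0" "s\<^sup>2 = 1 + (Re (a j))\<^sup>2"
        by (simp_all add: s_def add_pos_nonneg)
      have "norm p = 1"
        using p limit_directions_subset_sphere[of f] by auto
      then have "(p $ 1)\<^sup>2 + (p $ 2)\<^sup>2 = 1"
        by (simp add: norm_vec_def L2_set_def sum_2)
      then have "(p $ 1 * s)\<^sup>2 = 1\<^sup>2"
        unfolding power_mult_distrib s(2) j(2) by (simp add: algebra_simps)
      then have "p $ 1 = 1 / s \<or> p $ 1 = - (1 / s)"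
        unfolding power2_eq_iff using s(1) by (auto simp: field_simps)
      then have "p = v j \<or> p = - v j"
        using j(2) by (auto simp: vec_eq_iff forall_2 v_def s_def)
      then show ?thesis
        using j(1) by blast
    qed
    moreover have "v j \<in> limit_directions f \<and> - v j \<in> limit_directions f" if j: "j \<in> {1..d}" for j
    proof -
      have "\<sigma> *\<^sub>R v j \<in> limit_directions f" if \<sigma>: "\<sigma>\<^sup>2 = 1" for \<sigma>
      proof -
        let ?n = "sqrt (1 + (Re (a j))\<^sup>2)"
        \<comment> \<open>For purely imaginary \<open>s\<close> and real \<open>a j\<close>, the
          vector \<open>(Im s, Im (a j * s))\<close> is \<open>Im s\<close> times
          \<open>(1, a j)\<close>; the sign \<open>\<sigma>\<close> covers both directions.\<close>
        let ?s = "Complex 0 (\<sigma> / ?n)"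
        have v: "\<sigma> *\<^sub>R v j = vector [Im ?s, Im (a j * ?s)]"
          by (simp add: vec_eq_iff forall_2 v_def)
        have "norm (vector [1, Re (a j)] :: real ^ 2) = ?n"
          by (simp add: norm2)
        moreover have "?n > 0"
          by (simp add: add_pos_nonneg)
        ultimately have "norm (\<sigma> *\<^sub>R v j) = 1"
          using \<sigma> by (simp add: v_def abs_square_eq_1)
        then show ?thesis
          using lead_form_root_limit_direction[OF c root[OF j], of ?s] unfolding v by blast
      qed
      from this[of 1] this[of "- 1"] show ?thesis by simp
    qed
    ultimately have "limit_directions f = (\<Union>j\<in>{1..d}. {v j, - v j})"
      by auto
    then show ?thesis
      unfolding if_P[OF True] v_def .
  next
    case False
    then obtain j where j: "j \<in> {1..d}" "a j \<notin> \<real>"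
      by blast
    then have im: "Im (a j) \<noteq> 0"
      by (simp add: complex_is_Real_iff)
    have "v \<in> limit_directions f" if "v \<in> sphere 0 1" for v
    proof -
      \<comment> \<open>The solution of \<open>Im s = v $ 1\<close> and
        \<open>Re (a j) * Im s + Im (a j) * Re s = v $ 2\<close>, which exists because
        \<open>Im (a j)\<close> is nonzero.\<close>
      define s where "s = Complex ((v $ 2 - Re (a j) * v $ 1) / Im (a j)) (v $ 1)"
      have v: "vector [Im s, Im (a j * s)] = v"
        using im by (simp add: vec_eq_iff forall_2 s_def)
      then show ?thesis
        using lead_form_root_limit_direction[OF c root[OF j(1)], of s] that by simp
    qed
    then have "limit_directions f = sphere 0 1"
      using limit_directions_subset_sphere[of f] by blast
    then show ?thesis
      unfolding if_not_P[OF False] .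
  qed
qed

end
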